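(* Let $\Delta\geq3$ be an integer and let $\ell_1,\ell_2,\dotsc,\ell_\Delta$ be positive integers. Then the spider $S_{\ell_1,\ell_2,\dotsc,\ell_\Delta}$ satisfies $d(S_{\ell_1,\ell_2,\dotsc,\ell_\Delta})=\left\lceil\frac{\Delta}{2}\right\rceil$.
   Context: A vertex labeling of a graph $G$ is an injective map $f:V(G)\to\mathbb{Z}$. It induces the edge labeling $f^-:E(G)\to\mathbb{Z}$, $f^-(uv)=|f(u)-f(v)|$, and $|f^-|$ denotes the number of distinct values $f^-$ takes on $E(G)$. The difference index $d(G)$ is the minimum positive integer $k$ such that there exists a vertex labeling $f$ of $G$ with $|f^-|=k$. The spider $S_{\ell_1,\ell_2,\dotsc,\ell_\Delta}$ is the graph consisting of a center vertex $v_0$ which serves as a common endpoint of $\Delta$ paths $v_0v_{i,1}v_{i,2}\dotsb v_{i,\ell_i}$, $1\leq i\leq\Delta$, where all the vertices $v_0$ and $v_{i,j}$ are distinct. *)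

theory Defs
  imports Complex_Main "Graph_Theory.Pair_Digraph"
begin

text \<open>
  A finite simple graph is a \<^locale>\<open>pair_graph\<close>: each edge \<open>uv\<close> is represented by the two arcs
  \<open>(u, v)\<close> and \<open>(v, u)\<close>. They have the same label, so passing to arcs does not change the set of
  labels.
\<close>

definition vertex_labeling :: "'a pair_pre_digraph \<Rightarrow> ('a \<Rightarrow> int) \<Rightarrow> bool" where
  "vertex_labeling G f \<longleftrightarrow> inj_on f (pverts G)"

definition edge_label :: "('a \<Rightarrow> int) \<Rightarrow> 'a \<times> 'a \<Rightarrow> int" where
  "edge_label f e = \<bar>f (fst e) - f (snd e)\<bar>"

definition num_edge_labels :: "'a pair_pre_digraph \<Rightarrow> ('a \<Rightarrow> int) \<Rightarrow> nat" where
  "num_edge_labels G f = card (edge_label f ` parcs G)"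

definition difference_index :: "'a pair_pre_digraph \<Rightarrow> nat" where
  "difference_index G =
     (LEAST k. 0 < k \<and> (\<exists>f. vertex_labeling G f \<and> num_edge_labels G f = k))"

text \<open>The minimum exists for every finite simple graph with at least one edge.\<close>

lemma (in pair_graph) difference_index_attained:
  assumes "parcs G \<noteq> {}"
  shows "0 < difference_index G \<and>
    (\<exists>f. vertex_labeling G f \<and> num_edge_labels G f = difference_index G)"
proof -
  obtain g :: "'a \<Rightarrow> nat" where "inj_on g (pverts G)"
    using finite_imp_inj_to_nat_seg[OF finite_verts] by auto
  then have lab: "vertex_labeling G (\<lambda>v. int (g v))"
    by (simp add: vertex_labeling_def inj_on_def)
  have "finite (parcs G)"
    using finite_arcs by simp
  with assms have "0 < num_edge_labels G (\<lambda>v. int (g v))"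
    by (simp add: num_edge_labels_def card_gt_0_iff)
  with lab have "\<exists>k. 0 < k \<and> (\<exists>f. vertex_labeling G f \<and> num_edge_labels G f = k)"
    by blast
  then show ?thesis
    unfolding difference_index_def by (rule LeastI_ex)
qed

datatype spider_vertex = Center | Leg nat nat

definition spider :: "nat \<Rightarrow> (nat \<Rightarrow> nat) \<Rightarrow> spider_vertex pair_pre_digraph" where
  "spider \<Delta> l =
    (let E = {(Center, Leg i 1) | i. i \<in> {1..\<Delta>}} \<union>
             {(Leg i j, Leg i (j + 1)) | i j. i \<in> {1..\<Delta>} \<and> 1 \<le> j \<and> j < l i}
     in \<lparr> pverts = insert Center {Leg i j | i j. i \<in> {1..\<Delta>} \<and> j \<in> {1..l i}},
          parcs = E \<union> E\<inverse> \<rparr>)"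

lemma pair_graph_spider:
  assumes "\<And>i. i \<in> {1..\<Delta>} \<Longrightarrow> 0 < l i"
  shows "pair_graph (spider \<Delta> l)"
proof -
  let ?G = "spider \<Delta> l"
  have "pverts ?G = insert Center ((\<lambda>(i, j). Leg i j) ` (SIGMA i:{1..\<Delta>}. {1..l i}))"
    by (auto simp: spider_def Let_def)
  then have fin: "finite (pverts ?G)"
    by simp
  have pos: "0 < i \<Longrightarrow> i \<le> \<Delta> \<Longrightarrow> l i \<noteq> 0" for i
    using assms[of i] by auto
  have wf: "fst e \<in> pverts ?G \<and> snd e \<in> pverts ?G \<and> fst e \<noteq> snd e" if "e \<in> parcs ?G" for e
    using that by (auto simp: spider_def Let_def Suc_le_eq dest: pos)
  have "parcs ?G \<subseteq> pverts ?G \<times> pverts ?G"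
    using wf by (auto simp: mem_Times_iff)
  then have fin': "finite (parcs ?G)"
    using fin finite_subset by blast
  have "sym (parcs ?G)"
    by (simp add: spider_def Let_def sym_Un_converse)
  then show ?thesis
    using fin fin' wf by unfold_locales (auto simp: symmetric_def)
qed

end

theory Submission
  imports Defs
begin

text \<open>
  Each edge label occurs at most twice around a vertex \<open>v\<close>, because a neighbour joined to \<open>v\<close> by an
  edge with label \<open>d\<close> must itself carry the value \<open>f v + d\<close> or \<open>f v - d\<close>. The center of the spider
  has \<open>\<Delta>\<close> neighbours, so every labeling uses at least \<open>\<Delta> / 2\<close> edge labels
  (\<open>degree_le_twice_num_edge_labels\<close>).

  Conversely, put \<open>0\<close> on the center, group the legs into pairs, and let the two legs of the \<open>p\<close>-th
  pair run through the positive and the negative multiples of a step \<open>d\<^sub>p\<close>. Then \<open>d\<^sub>p\<close> is the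
  label of every edge on both legs, so there are as many labels as pairs, where for odd \<open>\<Delta>\<close> the
  last pair is a single leg: at most \<open>(\<Delta> + 1) div 2\<close> labels in all. The labeling is
  injective once small multiples of different steps never coincide, and the powers
  \<open>d\<^sub>p = B ^ p\<close> of a base \<open>B\<close> larger than all leg lengths have this property
  (\<open>small_multiples_of_powers_eq_iff\<close>).
\<close>

lemma (in pair_graph) degree_le_twice_num_edge_labels:
  assumes "vertex_labeling G f"
  shows "card {w. (v, w) \<in> parcs G} \<le> 2 * num_edge_labels G f"
proof -
  let ?N = "{w. (v, w) \<in> parcs G}" and ?D = "edge_label f ` parcs G"
  have "finite ?D"
    using finite_arcs by simp
  have "?N \<subseteq> pverts G"
    using in_arcsD2 by blast
  then have "card ?N = card (f ` ?N)"
    using assms by (metis card_image inj_on_subset vertex_labeling_def)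
  also have "\<dots> \<le> card (\<Union>d\<in>?D. {f v + d, f v - d})"
  proof (rule card_mono)
    show "finite (\<Union>d\<in>?D. {f v + d, f v - d})"
      using \<open>finite ?D\<close> by blast
    have "f w \<in> {f v + edge_label f (v, w), f v - edge_label f (v, w)}" for w
      by (auto simp: edge_label_def)
    then show "f ` ?N \<subseteq> (\<Union>d\<in>?D. {f v + d, f v - d})"
      by blast
  qed
  also have "\<dots> \<le> (\<Sum>d\<in>?D. card {f v + d, f v - d})"
    using \<open>finite ?D\<close> by (rule card_UN_le)
  also have "\<dots> \<le> (\<Sum>d\<in>?D. 2)"
    by (intro sum_mono) (simp add: card_insert_if)
  finally show ?thesis
    by (simp add: num_edge_labels_def)
qed

lemma card_neighbours_Center: "card {w. (Center, w) \<in> parcs (spider \<Delta> l)} = \<Delta>"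
proof -
  have "{w. (Center, w) \<in> parcs (spider \<Delta> l)} = (\<lambda>i. Leg i 1) ` {1..\<Delta>}"
    by (auto simp: spider_def Let_def)
  then show ?thesis
    by (simp add: card_image inj_on_def)
qed

lemma small_multiples_of_powers_eq_iff:
  fixes B a b j k :: nat
  assumes "0 < j" "j < B" "0 < k" "k < B"
  shows "B ^ a * j = B ^ b * k \<longleftrightarrow> a = b \<and> j = k"
proof -
  \<comment> \<open>The multiples \<open>B ^ a * j\<close> with \<open>0 < j < B\<close> lie in \<open>{B ^ a..<B ^ Suc a}\<close>, and these intervals
    are disjoint for different \<open>a\<close>.\<close>
  have less: "B ^ a * j < B ^ b * k" if "a < b" "j < B" "0 < k" for a b j k :: nat
  proof -
    have "B ^ a * j < B ^ Suc a"
      using that by simp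
    also have "\<dots> \<le> B ^ b"
      using that by (intro power_increasing) auto
    also have "\<dots> \<le> B ^ b * k"
      using that by simp
    finally show ?thesis .
  qed
  show ?thesis
    using less[of a b j k] less[of b a k j] assms by (cases a b rule: linorder_cases) auto
qed

text \<open>Legs \<open>2 * p - 1\<close> and \<open>2 * p\<close> form the \<open>p\<close>-th pair: the parity of the leg gives the sign and
  \<open>(i + 1) div 2\<close> the index of its pair.\<close>

fun paired_labeling :: "nat \<Rightarrow> spider_vertex \<Rightarrow> int" where
  "paired_labeling B Center = 0"
| "paired_labeling B (Leg i j) = (- 1) ^ i * int (B ^ ((i + 1) div 2) * j)"

lemma paired_labeling_Leg_eq_iff:
  assumes "0 < j" "j < B" "0 < j'" "j' < B"
  shows "paired_labeling B (Leg i j) = paired_labeling B (Leg i' j') \<longleftrightarrow> i = i' \<and> j = j'"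
proof
  assume eq: "paired_labeling B (Leg i j) = paired_labeling B (Leg i' j')"
  have "even i \<longleftrightarrow> even i'" "m = m'"
    if "(- 1) ^ i * int m = (- 1) ^ i' * int m'" "0 < m" "0 < m'" for m m'
    using that by (auto simp: minus_one_power_iff split: if_splits)
  note sign_and_modulus = this[OF eq[unfolded paired_labeling.simps]]
  have "even i \<longleftrightarrow> even i'" "B ^ ((i + 1) div 2) * j = B ^ ((i' + 1) div 2) * j'"
    using assms by (intro sign_and_modulus; simp)+
  then have "(i + 1) div 2 = (i' + 1) div 2" "j = j'"
    using assms by (simp_all add: small_multiples_of_powers_eq_iff)
  moreover have "i = i'"
    using \<open>even i \<longleftrightarrow> even i'\<close> \<open>(i + 1) div 2 = (i' + 1) div 2\<close> by presburger
  ultimately show "i = i' \<and> j = j'"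
    by simp
qed simp

lemma vertex_labeling_paired_labeling:
  assumes "\<And>i. i \<in> {1..\<Delta>} \<Longrightarrow> l i < B"
  shows "vertex_labeling (spider \<Delta> l) (paired_labeling B)"
  unfolding vertex_labeling_def
proof (rule inj_onI)
  have leg: "0 < j \<and> j < B" if "Leg i j \<in> pverts (spider \<Delta> l)" for i j
    using that assms[of i] by (auto simp: spider_def Let_def)
  fix u v
  assume "u \<in> pverts (spider \<Delta> l)" "v \<in> pverts (spider \<Delta> l)"
    and "paired_labeling B u = paired_labeling B v"
  then show "u = v"
    by (cases u; cases v)
      (auto dest!: leg simp: paired_labeling_Leg_eq_iff simp del: paired_labeling.simps(2),
       auto)
qed

lemma num_edge_labels_paired_labeling:
  "num_edge_labels (spider \<Delta> l) (paired_labeling B) \<le> (\<Delta> + 1) div 2"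
proof -
  let ?P = "{1..(\<Delta> + 1) div 2}"
  have first: "edge_label (paired_labeling B) (Center, Leg i 1) = int (B ^ ((i + 1) div 2))"
    and step: "edge_label (paired_labeling B) (Leg i j, Leg i (j + 1)) = int (B ^ ((i + 1) div 2))"
    for i j
    by (cases "even i"; simp add: edge_label_def algebra_simps)+
  have sym: "edge_label f (u, v) = edge_label f (v, u)" for f :: "spider_vertex \<Rightarrow> int" and u v
    by (simp add: edge_label_def)
  have pair: "(i + 1) div 2 \<in> ?P" if "i \<in> {1..\<Delta>}" for i
    using that by (auto intro!: div_le_mono)
  have "edge_label (paired_labeling B) e \<in> (\<lambda>p. int (B ^ p)) ` ?P"
    if "e \<in> parcs (spider \<Delta> l)" for e
  proof -
    from that consider i where "i \<in> {1..\<Delta>}" "e = (Center, Leg i 1) \<or> e = (Leg i 1, Center)"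
      | i j where "i \<in> {1..\<Delta>}"
          "e = (Leg i j, Leg i (j + 1)) \<or> e = (Leg i (j + 1), Leg i j)"
      by (fastforce simp: spider_def Let_def)
    then obtain i where "i \<in> {1..\<Delta>}"
        "edge_label (paired_labeling B) e = int (B ^ ((i + 1) div 2))"
      using first step sym by metis
    then show ?thesis
      using pair by blast
  qed
  then have "edge_label (paired_labeling B) ` parcs (spider \<Delta> l) \<subseteq> (\<lambda>p. int (B ^ p)) ` ?P"
    by blast
  then have "num_edge_labels (spider \<Delta> l) (paired_labeling B) \<le> card ?P"
    unfolding num_edge_labels_def by (rule surj_card_le[rotated]) simp
  then show ?thesis
    by simp
qed

theorem theorem3p10:
  fixes \<Delta> :: nat and l :: "nat \<Rightarrow> nat"
  assumes "\<Delta> \<ge> 3" and "\<And>i. i \<in> {1..\<Delta>} \<Longrightarrow> l i > 0"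
  shows "int (difference_index (spider \<Delta> l)) = \<lceil>real \<Delta> / 2\<rceil>"
proof -
  let ?G = "spider \<Delta> l" and ?k = "(\<Delta> + 1) div 2"
  interpret pair_graph ?G
    using assms(2) by (rule pair_graph_spider)
  have lower: "?k \<le> num_edge_labels ?G f" if "vertex_labeling ?G f" for f
    using degree_le_twice_num_edge_labels[OF that, of Center]
    unfolding card_neighbours_Center by linarith
  define B where "B = Suc (\<Sum>i\<in>{1..\<Delta>}. l i)"
  have "l i < B" if "i \<in> {1..\<Delta>}" for i
    using that by (simp add: B_def less_Suc_eq_le member_le_sum)
  then have lab: "vertex_labeling ?G (paired_labeling B)"
    by (rule vertex_labeling_paired_labeling)
  then have "num_edge_labels ?G (paired_labeling B) = ?k"
    using lower num_edge_labels_paired_labeling by (intro antisym)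
  with lab lower have "difference_index ?G = ?k"
    unfolding difference_index_def using \<open>\<Delta> \<ge> 3\<close> by (intro Least_equality) auto
  moreover have "\<lceil>real \<Delta> / 2\<rceil> = int ?k"
    by (cases "even \<Delta>") (auto elim!: evenE oddE simp: ceiling_eq_iff)
  ultimately show ?thesis
    by simp
qed

end
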